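(* Let $T$ be a tree. For $j\ge1$ let $L_j$ be the set of vertices of $T$ whose distance to the nearest leaf is $j-1$ (so $L_1$ is the set of leaves), and let $\ell_j=|L_j|$. Then for every positive integer $k$ such that $L_k$ is nonempty, \[Z^{(k)}(T)\leq \sum_{i=1}^k \ell_i - 1.\]
   Context: Zero forcing on a simple graph $H$: an initial set is blue; repeatedly, a blue vertex with exactly one white neighbor forces that neighbor blue; $Z(H)$ is the minimum size of an initial set making all vertices blue. A lazy walk of length $r$ in $T$ is a sequence $u_0,\ldots,u_r$ with $u_{t+1}=u_t$ or $u_tu_{t+1}\in E(T)$. $\Gamma(T,r)$ is the multigraph on $V(T)$ with the number of edges between distinct $i,j$ equal to the number of lazy walks from $i$ to $j$ of length at most $r$. An edge configuration of a multigraph $\Gamma$ is a simple graph $H$ on its vertex set such that a pair joined by exactly one edge in $\Gamma$ is an edge of $H$, a pair joined by no edge is not, and a pair joined by two or more edges may or may not be. $Z^{(r)}(T)=\max Z(H)$ over all edge configurations $H$ of $\Gamma(T,r)$. *)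

theory Defs
  imports "Graph_Theory.Graph_Theory"
begin

text \<open>
  A finite simple graph is a \<^locale>\<open>pair_graph\<close>: each undirected edge is represented by the
  two arcs in opposite directions. The library's \<open>tree\<close> is not usable on such symmetric
  digraphs, since it counts the back-and-forth walk along a single edge as a cycle; undirected
  cycles are the library cycles of length at least 3.
\<close>

definition undirected_tree :: "'a pair_pre_digraph \<Rightarrow> bool" where
  "undirected_tree T \<longleftrightarrow>
     pair_graph T \<and> connected (with_proj T) \<and>
     \<not> (\<exists>p. pre_digraph.cycle (with_proj T) p \<and> length p \<ge> 3)"

definition leaves :: "'a pair_pre_digraph \<Rightarrow> 'a set" where
  "leaves T = {v \<in> pverts T. out_degree (with_proj T) v = 1}"

definition graph_dist :: "'a pair_pre_digraph \<Rightarrow> 'a \<Rightarrow> 'a \<Rightarrow> ereal" where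
  "graph_dist G u v = wf_digraph.\<mu> (with_proj G) (\<lambda>_. 1) u v"

text \<open>If there is no leaf, the infimum is \<open>\<infinity>\<close> and all levels are empty.\<close>

definition leaf_level :: "'a pair_pre_digraph \<Rightarrow> nat \<Rightarrow> 'a set" where
  "leaf_level T j = {v \<in> pverts T. (INF w\<in>leaves T. graph_dist T v w) = ereal (real j - 1)}"

definition zf_step :: "'a pair_pre_digraph \<Rightarrow> 'a set \<Rightarrow> 'a set \<Rightarrow> bool" where
  "zf_step H B B' \<longleftrightarrow>
     (\<exists>u\<in>B. \<exists>v. {w. (u, w) \<in> parcs H \<and> w \<notin> B} = {v} \<and> B' = insert v B)"

definition zero_forcing_set :: "'a pair_pre_digraph \<Rightarrow> 'a set \<Rightarrow> bool" where
  "zero_forcing_set H B \<longleftrightarrow> B \<subseteq> pverts H \<and> (zf_step H)\<^sup>*\<^sup>* B (pverts H)"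

definition zero_forcing_number :: "'a pair_pre_digraph \<Rightarrow> nat" where
  "zero_forcing_number H = Min (card ` {B. zero_forcing_set H B})"

definition lazy_walk :: "'a pair_pre_digraph \<Rightarrow> nat \<Rightarrow> 'a list \<Rightarrow> bool" where
  "lazy_walk T r us \<longleftrightarrow>
     length us = Suc r \<and> set us \<subseteq> pverts T \<and>
     (\<forall>t<r. us ! Suc t = us ! t \<or> (us ! t, us ! Suc t) \<in> parcs T)"

text \<open>
  The arcs of the multigraph \<open>\<Gamma>(T, r)\<close> are the lazy walks themselves. Reversing walks shows
  that it is a symmetric digraph without loops, so \<open>edge_mult\<close> counts every undirected edge
  between two vertices exactly once.
\<close>

definition walk_multigraph :: "'a pair_pre_digraph \<Rightarrow> nat \<Rightarrow> ('a, 'a list) pre_digraph" where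
  "walk_multigraph T r =
     \<lparr> verts = pverts T,
       arcs = {us. (\<exists>s\<le>r. lazy_walk T s us) \<and> hd us \<noteq> last us},
       tail = hd, head = last \<rparr>"

definition edge_mult :: "('a, 'b) pre_digraph \<Rightarrow> 'a \<Rightarrow> 'a \<Rightarrow> nat" where
  "edge_mult \<Gamma> i j = card {e \<in> arcs \<Gamma>. tail \<Gamma> e = i \<and> head \<Gamma> e = j}"

definition edge_configuration :: "('a, 'b) pre_digraph \<Rightarrow> 'a pair_pre_digraph \<Rightarrow> bool" where
  "edge_configuration \<Gamma> H \<longleftrightarrow>
     pair_graph H \<and> pverts H = verts \<Gamma> \<and>
     (\<forall>i\<in>verts \<Gamma>. \<forall>j\<in>verts \<Gamma>. i \<noteq> j \<longrightarrow>
        (edge_mult \<Gamma> i j = 1 \<longrightarrow> (i, j) \<in> parcs H) \<and>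
        (edge_mult \<Gamma> i j = 0 \<longrightarrow> (i, j) \<notin> parcs H))"

definition max_zero_forcing_number :: "nat \<Rightarrow> 'a pair_pre_digraph \<Rightarrow> nat" where
  "max_zero_forcing_number r T =
     Max (zero_forcing_number ` {H. edge_configuration (walk_multigraph T r) H})"

end

theory Submission
  imports Defs
begin

text \<open>
  Root \<open>T\<close> at a leaf \<open>z\<close> at distance \<open>k - 1\<close> from some vertex of \<open>L\<^sub>k\<close>; then some vertex has depth
  \<open>k\<close>. Colour all of \<open>L\<^sub>1 \<union> \<dots> \<union> L\<^sub>k\<close> except \<open>z\<close> blue. A white vertex \<open>w\<close> has a descendant \<open>v\<close>
  exactly \<open>k\<close> levels below it, because a white \<open>w \<noteq> z\<close> has distance at least \<open>k\<close> to every leaf. The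
  only lazy walk of length at most \<open>k\<close> from \<open>v\<close> to depth at most the depth of \<open>w\<close> climbs straight to
  \<open>w\<close>. So \<open>vw\<close> is a single edge of \<open>\<Gamma>(T, k)\<close>, and in every configuration all other neighbours of \<open>v\<close>
  lie strictly deeper than \<open>w\<close>. Hence the white vertices can be forced in order of decreasing depth.
\<close>

section \<open>Attained minima and reversal of lazy walks\<close>

text \<open>Distances between vertices and distances to the nearest leaf are infima in
  \<open>ereal\<close>. Since their values come from natural numbers, well-ordering turns them into
  minima with a witness.\<close>

lemma INF_nat_attained:
  fixes f :: "'b \<Rightarrow> nat"
  assumes "A \<noteq> {}"
  shows "\<exists>a\<in>A. (INF x\<in>A. ereal (real (f x))) = ereal (real (f a)) \<and> (\<forall>x\<in>A. f a \<le> f x)"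
proof -
  obtain a where a: "a \<in> A" "\<And>x. x \<in> A \<Longrightarrow> f a \<le> f x"
    using assms exists_least_iff[of "\<lambda>n. n \<in> f ` A"] by (metis all_not_in_conv image_iff not_le)
  then have "(INF x\<in>A. ereal (real (f x))) = ereal (real (f a))"
    by (intro INF_eqI) auto
  with a show ?thesis by blast
qed

lemma lazy_walk_rev:
  assumes "sym (parcs T)" "lazy_walk T s us"
  shows "lazy_walk T s (rev us)"
proof -
  have "rev us ! Suc t = rev us ! t \<or> (rev us ! t, rev us ! Suc t) \<in> parcs T" if "t < s" for t
  proof -
    let ?t = "s - Suc t"
    have t: "?t < s" "Suc ?t = s - t" and len: "length us = Suc s"
      using that assms(2) by (auto simp: lazy_walk_def)
    then have "us ! Suc ?t = us ! ?t \<or> (us ! ?t, us ! Suc ?t) \<in> parcs T"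
      using assms(2) unfolding lazy_walk_def by blast
    then show ?thesis using that len t(2) assms(1) by (auto simp: rev_nth dest: symD)
  qed
  then show ?thesis using assms(2) by (auto simp: lazy_walk_def)
qed

text \<open>Reversal is an involution that exchanges the lazy walks from \<open>i\<close> to
  \<open>j\<close> with those from \<open>j\<close> to \<open>i\<close>. The symmetry is what makes
  the single edges of \<Gamma> an undirected graph.\<close>

lemma edge_mult_commute:
  assumes "sym (parcs T)"
  shows "edge_mult (walk_multigraph T r) i j = edge_mult (walk_multigraph T r) j i"
proof -
  define E where
    "E i j = {e \<in> arcs (walk_multigraph T r).
       tail (walk_multigraph T r) e = i \<and> head (walk_multigraph T r) e = j}" for i j
  have sub: "rev ` E i j \<subseteq> E j i" for i j
    by (auto simp: E_def walk_multigraph_def hd_rev last_rev intro: lazy_walk_rev[OF assms])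
  have "us \<in> rev ` E i j" if "us \<in> E j i" for us
    using sub[of j i] that by (intro image_eqI[of _ _ "rev us"]) auto
  then have "E j i = rev ` E i j" using sub[of i j] by blast
  then have "card (E j i) = card (E i j)" by (simp add: card_image)
  then show ?thesis by (simp add: edge_mult_def E_def)
qed

lemma lazy_walk_of_relpow:
  assumes "(u, v) \<in> parcs T ^^ n" "u \<in> pverts T" "pair_wf_digraph T"
  shows "\<exists>us. lazy_walk T n us \<and> hd us = u \<and> last us = v"
proof -
  obtain f where f: "f 0 = u" "f n = v" "\<And>i. i < n \<Longrightarrow> (f i, f (Suc i)) \<in> parcs T"
    using assms(1) by (auto simp: relpow_fun_conv)
  have V: "f i \<in> pverts T" if "i \<le> n" for i
    using that f(1) f(3)[of "i - 1"] assms(2) pair_wf_digraph.in_arcsD2[OF assms(3)] by (cases i) auto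
  have "lazy_walk T n (map f [0..<Suc n])"
    using f V by (auto simp: lazy_walk_def nth_append simp del: upt_Suc)
  moreover have "hd (map f [0..<Suc n]) = u" "last (map f [0..<Suc n]) = v"
    using f by (simp_all add: hd_map del: upt_Suc) (simp add: upt_Suc)
  ultimately show ?thesis by blast
qed

subsection \<open>Distance levels\<close>

context pair_wf_digraph
begin

text \<open>Bridge from arc walks to powers of the arc relation. The condition on \<open>u\<close>
  is needed because the zeroth power also relates elements outside the graph to themselves.\<close>

lemma awalk_iff_relpow:
  "(\<exists>p. awalk u p v \<and> length p = n) \<longleftrightarrow> u \<in> pverts G \<and> (u, v) \<in> parcs G ^^ n"
proof (induct n arbitrary: u)
  case 0
  then show ?case by (auto simp: awalk_Nil_iff)
next
  case (Suc n)
  have "(\<exists>p. awalk u p v \<and> length p = Suc n) \<longleftrightarrow>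
      (\<exists>x. (u, x) \<in> parcs G \<and> (\<exists>p. awalk x p v \<and> length p = n))"
  proof
    assume "\<exists>p. awalk u p v \<and> length p = Suc n"
    then obtain e p where "awalk u (e # p) v" "length p = n" by (auto simp: length_Suc_conv)
    then show "\<exists>x. (u, x) \<in> parcs G \<and> (\<exists>p. awalk x p v \<and> length p = n)"
      by (cases e) (auto simp: awalk_Cons_iff)
  next
    assume "\<exists>x. (u, x) \<in> parcs G \<and> (\<exists>p. awalk x p v \<and> length p = n)"
    then obtain x p where "(u, x) \<in> parcs G" "awalk x p v" "length p = n" by blast
    then show "\<exists>p. awalk u p v \<and> length p = Suc n"
      by (intro exI[of _ "(u, x) # p"]) (simp add: awalk_Cons_iff)
  qed
  also have "\<dots> \<longleftrightarrow> u \<in> pverts G \<and> (u, v) \<in> parcs G ^^ Suc n"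
    unfolding Suc by (meson in_arcsD1 in_arcsD2 relpow_Suc_I2 relpow_Suc_E2)
  finally show ?case .
qed

text \<open>With unit costs the cost of a walk is its length, so the distance is the least exponent
  of the arc relation that joins the two vertices.\<close>

lemma graph_dist_attained:
  assumes "u \<rightarrow>\<^sup>*\<^bsub>with_proj G\<^esub> v"
  shows "\<exists>n. graph_dist G u v = ereal (real n) \<and> (u, v) \<in> parcs G ^^ n \<and>
    (\<forall>m. (u, v) \<in> parcs G ^^ m \<longrightarrow> n \<le> m)"
proof -
  have cost: "awalk_cost (\<lambda>_. 1) p = real (length p)" for p :: "('a \<times> 'a) list"
    by (induct p) auto
  have ne: "{p. awalk u p v} \<noteq> {}" using assms by (auto simp: reachable_awalk)
  obtain p where p: "awalk u p v" "\<And>q. awalk u q v \<Longrightarrow> length p \<le> length q"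
    and eq: "graph_dist G u v = ereal (real (length p))"
    using INF_nat_attained[OF ne, of length] unfolding graph_dist_def \<mu>_def cost by auto
  then have "(u, v) \<in> parcs G ^^ length p" "u \<in> pverts G"
    using awalk_iff_relpow[of u v "length p"] by blast+
  moreover have "length p \<le> m" if "(u, v) \<in> parcs G ^^ m" for m
    using awalk_iff_relpow[of u v m] p(2) that \<open>u \<in> pverts G\<close> by blast
  ultimately show ?thesis using eq by blast
qed

end

text \<open>Strong connectivity makes every distance to a leaf a natural number, and a nearest leaf
  exists by well-ordering. The \<open>Suc\<close> reflects that level \<open>j\<close> means
  distance \<open>j - 1\<close>.\<close>

lemma leaf_distances:
  assumes "pair_wf_digraph T" "strongly_connected (with_proj T)" "v \<in> pverts T"
    and "leaves T \<noteq> {}"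
  shows "\<exists>z\<in>leaves T. \<exists>n. v \<in> leaf_level T (Suc n) \<and> (v, z) \<in> parcs T ^^ n \<and>
    (\<forall>x\<in>leaves T. \<forall>m. (v, x) \<in> parcs T ^^ m \<longrightarrow> n \<le> m)"
proof -
  interpret pair_wf_digraph T by fact
  have "\<forall>x\<in>leaves T. \<exists>n. graph_dist T v x = ereal (real n) \<and> (v, x) \<in> parcs T ^^ n \<and>
      (\<forall>m. (v, x) \<in> parcs T ^^ m \<longrightarrow> n \<le> m)"
    using assms(2,3) by (intro ballI graph_dist_attained) (auto simp: leaves_def)
  then obtain f where f: "\<And>x. x \<in> leaves T \<Longrightarrow> graph_dist T v x = ereal (real (f x))"
    "\<And>x. x \<in> leaves T \<Longrightarrow> (v, x) \<in> parcs T ^^ f x"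
    "\<And>x m. x \<in> leaves T \<Longrightarrow> (v, x) \<in> parcs T ^^ m \<Longrightarrow> f x \<le> m"
    by metis
  obtain z where z: "z \<in> leaves T" "(INF x\<in>leaves T. ereal (real (f x))) = ereal (real (f z))"
    "\<And>x. x \<in> leaves T \<Longrightarrow> f z \<le> f x"
    using INF_nat_attained[OF assms(4), of f] by blast
  have "(INF x\<in>leaves T. graph_dist T v x) = ereal (real (f z))"
    using z(2) f(1) by simp
  then have "v \<in> leaf_level T (Suc (f z))"
    using assms(3) by (simp add: leaf_level_def)
  then show ?thesis using z f(2,3) by (meson order_trans)
qed

lemma leaf_level_unique:
  assumes "v \<in> leaf_level T i" "v \<in> leaf_level T j"
  shows "i = j"
  using assms by (auto simp: leaf_level_def)

subsection \<open>Rooted trees\<close>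

locale rooted_tree = pair_graph G for G :: "'a pair_pre_digraph" +
  fixes z :: 'a
  assumes root: "z \<in> pverts G"
    and reach_root: "u \<in> pverts G \<Longrightarrow> (u, z) \<in> (parcs G)\<^sup>*"
    and no_cycle: "cycle p \<Longrightarrow> length p < 3"
begin

definition depth :: "'a \<Rightarrow> nat" where
  "depth u = (LEAST n. (u, z) \<in> parcs G ^^ n)"

lemma depth_le: "(u, z) \<in> parcs G ^^ n \<Longrightarrow> depth u \<le> n"
  unfolding depth_def by (rule Least_le)

lemma relpow_depth: "u \<in> pverts G \<Longrightarrow> (u, z) \<in> parcs G ^^ depth u"
  unfolding depth_def using reach_root rtrancl_power by (metis LeastI_ex)

lemma depth_root [simp]: "depth z = 0"
  using depth_le[of z 0] by simp

lemma depth_eq_0: "u \<in> pverts G \<Longrightarrow> depth u = 0 \<Longrightarrow> u = z"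
  using relpow_depth[of u] by simp

lemma depth_arc: "(u, v) \<in> parcs G \<Longrightarrow> depth u \<le> Suc (depth v)"
  using relpow_depth[of v] in_arcsD2[of u v] relpow_Suc_I2[of u v "parcs G" z] by (intro depth_le) blast

lemma depth_pred:
  assumes "u \<in> pverts G" "u \<noteq> z"
  shows "\<exists>v. (u, v) \<in> parcs G \<and> depth u = Suc (depth v)"
proof -
  obtain n where n: "depth u = Suc n" using depth_eq_0 assms by (cases "depth u") auto
  with relpow_depth[OF assms(1)] obtain v where v: "(u, v) \<in> parcs G" "(v, z) \<in> parcs G ^^ n"
    by (metis relpow_Suc_E2)
  with depth_le[OF v(2)] depth_arc[OF v(1)] n show ?thesis by auto
qed

section \<open>Parents and descendants\<close>

text \<open>Such a connection, shortened to a path, closes up through \<open>w\<close> to a cycle.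
  As \<open>a \<noteq> b\<close>, the path has at least one arc, so the cycle has length at least
  3.\<close>

lemma no_detour:
  assumes "(w, a) \<in> parcs G" "(w, b) \<in> parcs G" "a \<noteq> b"
  shows "(a, b) \<notin> {(x, y) \<in> parcs G. x \<noteq> w \<and> y \<noteq> w}\<^sup>*"
proof
  let ?S = "{(x, y) \<in> parcs G. x \<noteq> w \<and> y \<noteq> w}"
  assume "(a, b) \<in> ?S\<^sup>*"
  then have "\<exists>p. awalk a p b \<and> set p \<subseteq> ?S"
  proof (induct rule: converse_rtrancl_induct)
    case base
    then show ?case using assms in_arcsD2 by (intro exI[of _ "[]"]) (auto simp: awalk_Nil_iff)
  next
    case (step x y)
    then obtain p where "awalk y p b" "set p \<subseteq> ?S" by blast
    with step(1) show ?case
      by (intro exI[of _ "(x, y) # p"]) (auto simp: awalk_Cons_iff)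
  qed
  then obtain p0 where p0: "awalk a p0 b" "set p0 \<subseteq> ?S" by blast
  define p where "p = awalk_to_apath p0"
  have p: "apath a p b" "set p \<subseteq> ?S"
    using p0 apath_awalk_to_apath awalk_to_apath_subset unfolding p_def by blast+
  have aw: "awalk a p b" and dist: "distinct (awalk_verts a p)" using p(1) by (auto simp: apath_def)
  have "w \<notin> set (awalk_verts a p)"
    using set_awalk_verts[OF aw] p(2) assms(1) no_loops' by fastforce
  moreover have bw: "(b, w) \<in> parcs G" using assms(2) arcs_symmetric by blast
  moreover have c: "awalk w ((w, a) # p @ [(b, w)]) w"
    using assms aw bw in_arcsD1 in_arcsD2 by (auto simp: awalk_simps)
  moreover have "awalk_verts a (p @ [(b, w)]) = awalk_verts a p @ [w]"
    using awalk_verts_append[of a p "[(b, w)]" w] aw bw in_arcsD2 by (auto simp: awalk_simps)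
  ultimately have "cycle ((w, a) # p @ [(b, w)])"
    using dist unfolding cycle_def by (intro exI[of _ w]) auto
  moreover have "p \<noteq> []" using aw assms(3) by (auto simp: awalk_Nil_iff)
  ultimately show False using no_cycle[of "(w, a) # p @ [(b, w)]"] by (cases p) auto
qed

text \<open>Depth drops strictly along a shortest path to the root, so after its start the path
  contains only vertices of depth less than \<open>depth w\<close>.\<close>

lemma root_path_avoids:
  assumes "u \<in> pverts G" "depth u \<le> depth w" "u \<noteq> w"
  shows "(u, z) \<in> {(x, y) \<in> parcs G. x \<noteq> w \<and> y \<noteq> w}\<^sup>*"
  using assms
proof (induct "depth u" arbitrary: u)
  case 0
  then have "u = z" using depth_eq_0 by simp
  then show ?case by simp
next
  case (Suc n)
  then have "u \<noteq> z" by auto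
  then obtain v where v: "(u, v) \<in> parcs G" "depth u = Suc (depth v)"
    using depth_pred Suc.prems by blast
  then have "v \<noteq> w" using Suc.prems by auto
  with v Suc have "(v, z) \<in> {(x, y) \<in> parcs G. x \<noteq> w \<and> y \<noteq> w}\<^sup>*"
    using in_arcsD2 by simp
  with v(1) \<open>v \<noteq> w\<close> \<open>u \<noteq> w\<close> show ?case by (simp add: converse_rtrancl_into_rtrancl)
qed

text \<open>Both neighbours reach the root without passing through \<open>w\<close>, so distinct
  ones would be joined by a detour around \<open>w\<close>. The weak inequalities also cover
  neighbours at the depth of \<open>w\<close>: every neighbour other than the parent is strictly
  deeper.\<close>

lemma parent_unique:
  assumes "(w, a) \<in> parcs G" "(w, b) \<in> parcs G" "depth a \<le> depth w" "depth b \<le> depth w"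
  shows "a = b"
proof (rule ccontr)
  assume "a \<noteq> b"
  let ?S = "{(x, y) \<in> parcs G. x \<noteq> w \<and> y \<noteq> w}"
  have "sym ?S" by (auto intro!: symI arcs_symmetric)
  moreover have "(a, z) \<in> ?S\<^sup>*" "(b, z) \<in> ?S\<^sup>*"
    using assms in_arcsD2 no_loops' by (auto intro!: root_path_avoids)
  ultimately have "(a, b) \<in> ?S\<^sup>*"
    by (meson rtrancl_trans symD sym_rtrancl)
  with no_detour[OF assms(1,2) \<open>a \<noteq> b\<close>] show False by blast
qed

text \<open>A vertex other than the root has a parent. If it is not a leaf, it has a second
  neighbour, which must be deeper because parents are unique.\<close>

lemma child_exists:
  assumes "x \<in> pverts G" "x \<notin> leaves G" "x \<noteq> z"
  shows "\<exists>y. (x, y) \<in> parcs G \<and> depth y = Suc (depth x)"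
proof -
  obtain a where a: "(x, a) \<in> parcs G" "depth x = Suc (depth a)"
    using depth_pred assms by blast
  have "\<exists>b. (x, b) \<in> parcs G \<and> b \<noteq> a"
  proof (rule ccontr)
    assume "\<nexists>b. (x, b) \<in> parcs G \<and> b \<noteq> a"
    then have only: "b = a" if "(x, b) \<in> parcs G" for b using that by blast
    have "out_arcs (with_proj G) x \<subseteq> {(x, a)}"
    proof
      fix e assume "e \<in> out_arcs (with_proj G) x"
      then obtain b where "e = (x, b)" "(x, b) \<in> parcs G" by (cases e) (auto simp: out_arcs_def)
      with only[of b] show "e \<in> {(x, a)}" by simp
    qed
    moreover have "(x, a) \<in> out_arcs (with_proj G) x" using a(1) by (simp add: out_arcs_def)
    ultimately have "out_arcs (with_proj G) x = {(x, a)}" by blast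
    then show False using assms(1,2) by (simp add: leaves_def out_degree_def)
  qed
  then obtain b where b: "(x, b) \<in> parcs G" "b \<noteq> a" by blast
  then have "\<not> depth b \<le> depth x" using parent_unique[OF a(1) b(1)] a(2) by auto
  moreover have "depth b \<le> Suc (depth x)" using depth_arc arcs_symmetric b(1) by blast
  ultimately show ?thesis using b(1) by (intro exI[of _ b]) auto
qed

text \<open>Descend from child to child: by hypothesis no leaf is met in fewer than \<open>k\<close>
  steps, and the root is not met because depth only grows from \<open>depth w > 0\<close>.\<close>

lemma descendant_exists:
  assumes "w \<in> pverts G" "w \<noteq> z"
    and "\<And>x m. m < k \<Longrightarrow> (w, x) \<in> parcs G ^^ m \<Longrightarrow> x \<notin> leaves G"
  shows "\<exists>v. v \<in> pverts G \<and> (w, v) \<in> parcs G ^^ k \<and> depth v = depth w + k"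
  using assms(3)
proof (induct k)
  case 0
  then show ?case using assms(1) by auto
next
  case (Suc k)
  then obtain v where v: "v \<in> pverts G" "(w, v) \<in> parcs G ^^ k" "depth v = depth w + k"
    by (meson less_SucI)
  have "v \<notin> leaves G" using Suc.prems v(2) by blast
  moreover have "v \<noteq> z" using v(3) assms(1,2) depth_eq_0 by auto
  ultimately obtain y where "(v, y) \<in> parcs G" "depth y = Suc (depth v)"
    using child_exists v(1) by blast
  then show ?case using v in_arcsD2 by (auto intro!: exI[of _ y])
qed

lemma relpow_sym: "(u, v) \<in> parcs G ^^ n \<Longrightarrow> (v, u) \<in> parcs G ^^ n"
proof (induct n arbitrary: v)
  case (Suc n)
  then obtain y where "(y, u) \<in> parcs G ^^ n" "(v, y) \<in> parcs G"
    using arcs_symmetric by (meson relpow_Suc_E)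
  then show ?case by (rule relpow_Suc_I2[rotated])
qed simp

section \<open>Steepest lazy walks\<close>

lemma lazy_walk_depth:
  assumes "lazy_walk G s us" "i \<le> j" "j \<le> s"
  shows "depth (us ! i) \<le> depth (us ! j) + (j - i)"
  using assms(2,3)
proof (induct j rule: dec_induct)
  case (step j)
  then have "us ! Suc j = us ! j \<or> (us ! j, us ! Suc j) \<in> parcs G"
    using assms(1) by (auto simp: lazy_walk_def)
  then have "depth (us ! j) \<le> Suc (depth (us ! Suc j))" using depth_arc by auto
  with step show ?case by auto
qed simp

text \<open>A lazy walk that climbs as many levels as its length allows never rests, and each of its
  steps goes to the unique parent.\<close>

lemma steep_lazy_walk_unique:
  assumes us: "lazy_walk G s us" "s \<le> k" "hd us = v" "depth (last us) + k \<le> depth v"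
    and us': "lazy_walk G s' us'" "s' \<le> k" "hd us' = v" "depth (last us') + k \<le> depth v"
  shows "us = us'"
proof -
  have steep: "r = k \<and> (\<forall>t\<le>k. depth (xs ! t) + t = depth v)"
    if xs: "lazy_walk G r xs" "r \<le> k" "hd xs = v" "depth (last xs) + k \<le> depth v" for r xs
  proof -
    have len: "length xs = Suc r" using xs(1) by (simp add: lazy_walk_def)
    then have "xs \<noteq> []" by auto
    then have xs0: "xs ! 0 = v" "xs ! r = last xs"
      using xs(3) len by (simp_all add: hd_conv_nth last_conv_nth)
    have rk: "r = k" using lazy_walk_depth[OF xs(1), of 0 r] xs xs0 by auto
    \<comment> \<open>The first \<open>t\<close> steps lose at most \<open>t\<close> levels and the
      remaining ones at most \<open>k - t\<close>. Since at least \<open>k\<close> levels are lost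
      in all, both bounds are exact.\<close>
    moreover have "depth (xs ! t) + t = depth v" if "t \<le> k" for t
      using lazy_walk_depth[OF xs(1), of 0 t] lazy_walk_depth[OF xs(1), of t r] xs xs0 that rk
      by auto
    ultimately show ?thesis by blast
  qed
  note S = steep[OF us] and S' = steep[OF us']
  have len: "length us = Suc k" "length us' = Suc k"
    using us(1) us'(1) S S' by (auto simp: lazy_walk_def)
  have "us ! t = us' ! t" if "t \<le> k" for t
    using that
  proof (induct t)
    case 0
    then show ?case using us(3) us'(3) len by (metis hd_conv_nth list.size(3) nat.distinct(1))
  next
    case (Suc t)
    have "depth (us ! Suc t) < depth (us ! t)" "depth (us' ! Suc t) < depth (us' ! t)"
      using S S' Suc.prems by (metis Suc_leD add_Suc_right add_less_cancel_right less_add_Suc1 add_Suc lessI)+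
    moreover from this have "(us ! t, us ! Suc t) \<in> parcs G" "(us' ! t, us' ! Suc t) \<in> parcs G"
      using us(1) us'(1) S S' Suc.prems unfolding lazy_walk_def by (metis Suc_le_eq less_irrefl)+
    ultimately show ?case using parent_unique Suc by (metis Suc_leD less_imp_le)
  qed
  then show ?thesis using len by (auto intro!: nth_equalityI)
qed

section \<open>Forcing in an edge configuration\<close>

text \<open>The two conclusions together let \<open>v\<close> force \<open>w\<close> as soon as
  everything deeper than \<open>w\<close> is blue. Both follow from uniqueness of the steepest walk
  from \<open>v\<close>, applied to walks ending at \<open>w\<close> and at
  \<open>u\<close>.\<close>

lemma configuration_forces:
  assumes H: "edge_configuration (walk_multigraph G k) H" and "k \<ge> 1"
    and w: "w \<in> pverts G" and v: "v \<in> pverts G" "(w, v) \<in> parcs G ^^ k" "depth v = depth w + k"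
  shows "(v, w) \<in> parcs H"
    and "(v, u) \<in> parcs H \<Longrightarrow> u \<noteq> w \<Longrightarrow> depth w < depth u"
proof -
  obtain us where us: "lazy_walk G k us" "hd us = v" "last us = w"
    using lazy_walk_of_relpow[OF relpow_sym[OF v(2)] v(1)] pair_wf_digraph_axioms by blast
  have "v \<noteq> w" using v(3) \<open>k \<ge> 1\<close> by auto
  have V: "verts (walk_multigraph G k) = pverts G" by (simp add: walk_multigraph_def)
  then have conf:
    "i \<in> pverts G \<Longrightarrow> j \<in> pverts G \<Longrightarrow> i \<noteq> j \<Longrightarrow> edge_mult (walk_multigraph G k) i j = 1 \<Longrightarrow>
      (i, j) \<in> parcs H"
    "i \<in> pverts G \<Longrightarrow> j \<in> pverts G \<Longrightarrow> i \<noteq> j \<Longrightarrow> edge_mult (walk_multigraph G k) i j = 0 \<Longrightarrow>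
      (i, j) \<notin> parcs H" for i j
    using H by (simp_all add: edge_configuration_def)
  have "{e \<in> arcs (walk_multigraph G k).
      tail (walk_multigraph G k) e = v \<and> head (walk_multigraph G k) e = w} = {us}"
    (is "?E = _")
  proof (intro equalityI subsetI)
    fix xs assume "xs \<in> ?E"
    then obtain s where "s \<le> k" "lazy_walk G s xs" "hd xs = v" "last xs = w"
      by (auto simp: walk_multigraph_def)
    then have "xs = us"
      using us v(3) by (intro steep_lazy_walk_unique[of s xs k v k us]) auto
    then show "xs \<in> {us}" by simp
  qed (use us \<open>v \<noteq> w\<close> in \<open>auto simp: walk_multigraph_def\<close>)
  then have "edge_mult (walk_multigraph G k) v w = 1"
    by (simp add: edge_mult_def)
  then show "(v, w) \<in> parcs H"
    using conf(1) v(1) w \<open>v \<noteq> w\<close> by simp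
  show "depth w < depth u" if "(v, u) \<in> parcs H" "u \<noteq> w"
  proof (rule ccontr)
    assume "\<not> depth w < depth u"
    interpret H: pair_graph H using H by (simp add: edge_configuration_def)
    have "u \<in> pverts G" "u \<noteq> v" using H.in_arcsD2[OF that(1)] H.no_loops'[OF that(1)] H
      by (auto simp: edge_configuration_def V)
    \<comment> \<open>An edge of \<open>H\<close> excludes only multiplicity zero; whether the pair
      is joined once or several times, some lazy walk from \<open>v\<close> to \<open>u\<close>
      exists.\<close>
    then have "edge_mult (walk_multigraph G k) v u \<noteq> 0"
      using conf(2)[of v u] v(1) that(1) by metis
    then have "{e \<in> arcs (walk_multigraph G k).
        tail (walk_multigraph G k) e = v \<and> head (walk_multigraph G k) e = u} \<noteq> {}"
      unfolding edge_mult_def by (metis (no_types, lifting) card.empty)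
    then obtain s xs where "s \<le> k" "lazy_walk G s xs" "hd xs = v" "last xs = u"
      by (auto simp: walk_multigraph_def)
    then have "xs = us"
      using us v(3) \<open>\<not> depth w < depth u\<close>
      by (intro steep_lazy_walk_unique[of s xs k v k us]) auto
    then show False using \<open>last xs = u\<close> us(3) that(2) by simp
  qed
qed

lemma zero_forcing_rooted:
  assumes H: "edge_configuration (walk_multigraph G k) H" and "k \<ge> 1"
    and "B \<subseteq> pverts G"
    and desc: "\<And>w. w \<in> pverts G - B \<Longrightarrow>
      \<exists>v\<in>pverts G. (w, v) \<in> parcs G ^^ k \<and> depth v = depth w + k"
  shows "zero_forcing_set H B"
proof -
  have V: "pverts H = pverts G" using H by (simp add: edge_configuration_def walk_multigraph_def)
  \<comment> \<open>The claim is generalised to all blue sets containing \<open>B\<close>, so that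
    induction on the number of white vertices applies after each force.\<close>
  have "(zf_step H)\<^sup>*\<^sup>* C (pverts G)" if "B \<subseteq> C" "C \<subseteq> pverts G" for C
    using that
  proof (induct "card (pverts G - C)" arbitrary: C)
    case 0
    then have "C = pverts G" using pair_finite_verts by auto
    then show ?case by simp
  next
    case (Suc n)
    let ?W = "pverts G - C"
    have fin: "finite ?W" "?W \<noteq> {}"
      using Suc.hyps(2) pair_finite_verts by (simp, force)
    obtain w where w: "w \<in> ?W" and deepest: "\<And>x. x \<in> ?W \<Longrightarrow> depth x \<le> depth w"
    proof -
      have "Max (depth ` ?W) \<in> depth ` ?W" using fin by (intro Max_in) auto
      then obtain w where "w \<in> ?W" "depth w = Max (depth ` ?W)" by force
      moreover from this have "depth x \<le> depth w" if "x \<in> ?W" for x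
        using fin(1) that by (metis Max_ge finite_imageI imageI)
      ultimately show thesis using that by blast
    qed
    obtain v where v: "v \<in> pverts G" "(w, v) \<in> parcs G ^^ k" "depth v = depth w + k"
      using desc[of w] w Suc.prems(1) by auto
    note force = configuration_forces[OF H \<open>k \<ge> 1\<close> _ v]
    \<comment> \<open>As \<open>k \<ge> 1\<close>, \<open>v\<close> is strictly deeper than the
      deepest white vertex, hence blue.\<close>
    have "v \<in> C" using deepest[of v] v(1,3) \<open>k \<ge> 1\<close> by fastforce
    moreover have "x = w" if "(v, x) \<in> parcs H" "x \<notin> C" for x
    proof -
      interpret H: pair_graph H using H by (simp add: edge_configuration_def)
      have "x \<in> ?W" using H.in_arcsD2[OF that(1)] that(2) V by simp
      then show ?thesis using force(2)[of x] that(1) deepest[of x] w by fastforce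
    qed
    then have "{x. (v, x) \<in> parcs H \<and> x \<notin> C} = {w}" using force(1) w by blast
    ultimately have "zf_step H C (insert w C)" unfolding zf_step_def by blast
    moreover have "(zf_step H)\<^sup>*\<^sup>* (insert w C) (pverts G)"
    proof (rule Suc.hyps(1))
      have "pverts G - insert w C = ?W - {w}" by blast
      then show "n = card (pverts G - insert w C)"
        using Suc.hyps(2) w fin by simp
    qed (use Suc.prems w in auto)
    ultimately show ?case by (rule converse_rtranclp_into_rtranclp)
  qed
  then show ?thesis using assms(3) V unfolding zero_forcing_set_def by simp
qed

end

section \<open>Maximum over all configurations\<close>

text \<open>\<open>Max\<close> and \<open>Min\<close> give usable bounds only on suitable finite
  sets. A configuration is determined by its arcs on a fixed finite vertex set, so there are
  finitely many; nonemptiness needs an explicit configuration.\<close>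

lemma max_zero_forcing_number_le:
  assumes "pair_graph T"
    and bound: "\<And>H. edge_configuration (walk_multigraph T r) H \<Longrightarrow>
      \<exists>B. zero_forcing_set H B \<and> card B \<le> n"
  shows "max_zero_forcing_number r T \<le> n"
proof -
  interpret pair_graph T by fact
  let ?\<Gamma> = "walk_multigraph T r"
  let ?C = "{H. edge_configuration ?\<Gamma> H}"
  have V: "verts ?\<Gamma> = pverts T" by (simp add: walk_multigraph_def)
  have sym: "sym (parcs T)" by (auto intro!: symI arcs_symmetric)
  have "?C \<subseteq> (\<lambda>E. \<lparr>pverts = pverts T, parcs = E\<rparr>) ` Pow (pverts T \<times> pverts T)"
  proof
    fix H assume "H \<in> ?C"
    then interpret H: pair_graph H by (simp add: edge_configuration_def)
    have "pverts H = pverts T" using \<open>H \<in> ?C\<close> V by (simp add: edge_configuration_def)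
    then show "H \<in> (\<lambda>E. \<lparr>pverts = pverts T, parcs = E\<rparr>) ` Pow (pverts T \<times> pverts T)"
      using H.in_arcsD1 H.in_arcsD2 by (intro image_eqI[of _ _ "parcs H"]) auto
  qed
  then have fin: "finite ?C"
    using pair_finite_verts by (meson finite_Pow_iff finite_SigmaI finite_imageI finite_subset)
  \<comment> \<open>The sparsest configuration: exactly the pairs joined by a single edge, with
    every optional edge left out.\<close>
  define E where "E = {(i, j) \<in> pverts T \<times> pverts T. i \<noteq> j \<and> edge_mult ?\<Gamma> i j = 1}"
  have "finite E" unfolding E_def
    by (rule finite_subset[of _ "pverts T \<times> pverts T"]) (use pair_finite_verts in auto)
  moreover have "sym E" unfolding E_def by (auto intro!: symI simp: edge_mult_commute[OF sym])
  ultimately have "pair_graph \<lparr>pverts = pverts T, parcs = E\<rparr>"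
    by unfold_locales (auto simp: symmetric_def E_def pair_finite_verts)
  then have "\<lparr>pverts = pverts T, parcs = E\<rparr> \<in> ?C"
    by (auto simp: edge_configuration_def V E_def)
  then have ne: "?C \<noteq> {}" by blast
  have "zero_forcing_number H \<le> n" if H: "H \<in> ?C" for H
  proof -
    obtain B where B: "zero_forcing_set H B" "card B \<le> n" using bound H by blast
    have "pverts H = pverts T" using H V by (simp add: edge_configuration_def)
    then have "{B. zero_forcing_set H B} \<subseteq> Pow (pverts T)"
      unfolding zero_forcing_set_def by blast
    then have "finite {B. zero_forcing_set H B}"
      using pair_finite_verts finite_subset by blast
    then have "zero_forcing_number H \<le> card B"
      unfolding zero_forcing_number_def using B(1) by (intro Min_le) auto
    with B(2) show ?thesis by simp
  qed
  then show ?thesis unfolding max_zero_forcing_number_def using fin ne by simp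
qed

section \<open>Choice of the root and count of the blue vertices\<close>

theorem mainTheorem7:
  fixes T :: "'a pair_pre_digraph" and k :: nat
  assumes "undirected_tree T"
    and "k \<ge> 1"
    and "leaf_level T k \<noteq> {}"
  shows "int (max_zero_forcing_number k T) \<le> (\<Sum>i=1..k. int (card (leaf_level T i))) - 1"
proof -
  interpret pair_graph T using assms(1) by (simp add: undirected_tree_def)
  have sc: "strongly_connected (with_proj T)"
    using symmetric_connected_imp_strongly_connected pair_sym_arcs assms(1)
    by (simp add: undirected_tree_def)
  obtain y where y: "y \<in> leaf_level T k" using assms(3) by blast
  then have yV: "y \<in> pverts T" by (simp add: leaf_level_def)
  have leaves: "leaves T \<noteq> {}"
  proof
    assume "leaves T = {}"
    with y show False by (simp add: leaf_level_def top_ereal_def)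
  qed
  note dist = leaf_distances[OF pair_wf_digraph_axioms sc _ leaves]
  \<comment> \<open>The root is a leaf nearest to \<open>y\<close>; uniqueness of levels gives its
    distance as \<open>k - 1\<close>.\<close>
  obtain z where z: "z \<in> leaves T" "(y, z) \<in> parcs T ^^ (k - 1)"
    and y_min: "\<And>x m. x \<in> leaves T \<Longrightarrow> (y, x) \<in> parcs T ^^ m \<Longrightarrow> k - 1 \<le> m"
    using dist[OF yV] leaf_level_unique[OF y] by (metis diff_Suc_1)
  have zV: "z \<in> pverts T" using z(1) by (simp add: leaves_def)
  have z1: "z \<in> leaf_level T 1"
  proof -
    have "(z, z) \<in> parcs T ^^ 0" by simp
    with dist[OF zV] z(1) show ?thesis by (metis One_nat_def le_zero_eq)
  qed
  interpret rooted_tree T z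
  proof
    fix u assume "u \<in> pverts T"
    then have "u \<rightarrow>\<^sup>*\<^bsub>with_proj T\<^esub> z" using sc zV by auto
    then obtain p where "awalk u p z" by (auto simp: reachable_awalk)
    then show "(u, z) \<in> (parcs T)\<^sup>*"
      using awalk_iff_relpow[of u z "length p"] relpow_imp_rtrancl by blast
  next
    fix p assume "cycle p"
    then show "length p < 3" using assms(1) unfolding undirected_tree_def by force
  qed (rule zV)
  define A where "A = (\<Union>i\<in>{1..k}. leaf_level T i)"
  have AV: "A \<subseteq> pverts T" by (auto simp: A_def leaf_level_def)
  have "z \<in> A" using z1 \<open>k \<ge> 1\<close> by (force simp: A_def)
  \<comment> \<open>A leaf within \<open>m < k\<close> steps would put \<open>w\<close> in a level
    \<open>Suc n\<close> with \<open>n \<le> m\<close>, hence in \<open>A\<close>.\<close>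
  have far: "x \<notin> leaves T" if w: "w \<in> pverts T - A" and "m < k" "(w, x) \<in> parcs T ^^ m" for w x m
  proof
    assume "x \<in> leaves T"
    have "w \<in> pverts T" using w by simp
    then obtain n where n: "w \<in> leaf_level T (Suc n)" "n \<le> m"
      using dist[of w] \<open>(w, x) \<in> parcs T ^^ m\<close> \<open>x \<in> leaves T\<close> by blast
    then have "w \<in> A" using \<open>m < k\<close> unfolding A_def by (intro UN_I[of "Suc n"]) auto
    with w show False by blast
  qed
  have dy: "depth y = k - 1"
    using depth_le[OF z(2)] y_min[OF z(1) relpow_depth[OF yV]] by simp
  \<comment> \<open>For \<open>k > 1\<close>, \<open>y\<close> is neither a leaf nor the root, and a
    child of it has depth \<open>k\<close>. For \<open>k = 1\<close>, \<open>y\<close> is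
    \<open>z\<close> itself, to which \<open>child_exists\<close> does not apply; the neighbour of
    this leaf serves instead.\<close>
  have "\<exists>v\<in>pverts T. depth v = k"
  proof (cases "k = 1")
    case True
    have "out_arcs (with_proj T) z \<noteq> {}"
      using z(1) by (auto simp: leaves_def out_degree_def)
    then obtain v where v: "(z, v) \<in> parcs T" by (auto simp: out_arcs_def)
    then have "v \<in> pverts T" "v \<noteq> z" using in_arcsD2 no_loops' by auto
    moreover have "depth v \<le> 1" using depth_arc[of v z] v arcs_symmetric by auto
    ultimately show ?thesis using True depth_eq_0[of v] by (intro bexI[of _ v]) linarith+
  next
    case False
    then have "y \<noteq> z" using dy \<open>k \<ge> 1\<close> by auto
    moreover have "y \<notin> leaves T" using y_min[of y 0] False \<open>k \<ge> 1\<close> by auto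
    ultimately show ?thesis using child_exists[OF yV] dy \<open>k \<ge> 1\<close> in_arcsD2 by fastforce
  qed
  \<comment> \<open>The white leaf \<open>z\<close> is treated separately:
    \<open>descendant_exists\<close> covers only vertices other than the root.\<close>
  then obtain v0 where v0: "v0 \<in> pverts T" "(z, v0) \<in> parcs T ^^ k" "depth v0 = k"
    using relpow_depth relpow_sym by blast
  have "\<exists>v\<in>pverts T. (w, v) \<in> parcs T ^^ k \<and> depth v = depth w + k"
    if "w \<in> pverts T - (A - {z})" for w
  proof (cases "w = z")
    case True
    then show ?thesis using v0 by auto
  next
    case False
    then have "w \<in> pverts T - A" using that by auto
    then show ?thesis using descendant_exists[of w k] far False by blast
  qed
  then have zf: "zero_forcing_set H (A - {z})"
    if "edge_configuration (walk_multigraph T k) H" for H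
    using zero_forcing_rooted[OF that \<open>k \<ge> 1\<close>, of "A - {z}"] AV by blast
  have "max_zero_forcing_number k T \<le> card (A - {z})"
    using zf by (intro max_zero_forcing_number_le) (auto intro: pair_graph)
  moreover have "finite A" using AV pair_finite_verts finite_subset by blast
  \<comment> \<open>Leaving the single leaf \<open>z\<close> white yields the \<open>- 1\<close> of
    the bound.\<close>
  then have "card (A - {z}) + 1 = card A" using \<open>z \<in> A\<close> using card_Suc_Diff1 by fastforce
  moreover have "card A \<le> (\<Sum>i=1..k. card (leaf_level T i))"
    unfolding A_def by (rule card_UN_le) simp
  ultimately have "int (max_zero_forcing_number k T) + 1 \<le> int (\<Sum>i=1..k. card (leaf_level T i))"
    by linarith
  then show ?thesis by simp
qed

end
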